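(* Let $(V,\lhd,\rhd,\circ)$ be a finite-dimensional pre-Gel'fand-Dorfman algebra over $\mathbb{C}$; write $a\ast b=a\rhd b+a\lhd b$ and $a\star b=a\rhd b+b\lhd a$. Suppose $V=V\ast V$ or $V=V\star V$ or $V=V\lhd V$ or $V=V\rhd V$. Let $R=\mathbb{C}[\partial]V$ be the corresponding quadratic left-symmetric conformal algebra, let $\beta\in\mathbb{C}$, and let $\widehat{R}=R\oplus\mathbb{C}\mathfrak{c}_\beta$ be a central extension of $R$ with $\lambda$-products $$\widehat{a_\lambda b}=\partial(b\lhd a)+a\circ b+\lambda(a\star b)+\alpha_\lambda(a,b)\mathfrak{c}_\beta,\qquad a,b\in V,$$ with $\alpha_\lambda(a,b)\in\mathbb{C}[\lambda]$. Then $\alpha_\lambda(a,b)=\sum_{i=0}^3\lambda^i\alpha_i(a,b)$ for all $a,b\in V$, where the $\alpha_i(\cdot,\cdot):V\times V\to\mathbb{C}$ are bilinear forms satisfying, for all $a,b,c\in V$: \begin{align*} &\alpha_3(a\ast b,c)=\alpha_3(b\ast a,c)=\alpha_3(a,c\lhd b)=\alpha_3(b,a\rhd c),\\ &\alpha_2(a\ast b,c)-\alpha_2(a,c\lhd b)-\beta\alpha_3(a,c\lhd b)-\alpha_3(a,b\circ c)=\alpha_3(b\circ a,c)-\alpha_3(a\circ b,c),\\ &2\alpha_2(a\ast b,c)-\alpha_2(b\ast a,c)-\alpha_2(a,b\star c)=3\alpha_3(b\circ a,c)-3\alpha_3(a\circ b,c),\\ &\alpha_1(a\ast b,c)-\alpha_1(a,c\lhd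 b)-\beta\alpha_2(a,c\lhd b)-\alpha_2(a,b\circ c)=\alpha_2(b\circ a,c)-\alpha_2(a\circ b,c),\\ &\alpha_1(a\ast b,c)-\alpha_1(b\ast a,c)-\alpha_1(a,b\star c)+\alpha_1(b,a\star c)=2\alpha_2(b\circ a,c)-2\alpha_2(a\circ b,c),\\ &\alpha_0(a\ast b,c)-\alpha_0(a,c\lhd b)+\alpha_0(b,a\star c)-\beta\alpha_1(a,c\lhd b)-\alpha_1(a,b\circ c)=\alpha_1(b\circ a,c)-\alpha_1(a\circ b,c),\\ &\alpha_0(a\circ b,c)-\beta\alpha_0(a,c\lhd b)-\alpha_0(a,b\circ c)=\alpha_0(b\circ a,c)-\beta\alpha_0(b,c\lhd a)-\alpha_0(b,a\circ c). \end{align*} Furthermore, $\alpha_\lambda(\cdot,\cdot)$ and $\alpha'_\lambda(\cdot,\cdot)$ (two such, with components $\alpha_i$, $\alpha_i'$) are equivalent if and only if $\alpha_i(\cdot,\cdot)=\alpha'_i(\cdot,\cdot)$ for $i=2,3$ and there is a linear map $\phi:V\to\mathbb{C}$ such that for all $a,b\in V$ $$\alpha_1(a,b)=\alpha'_1(a,b)+\phi(a\rhd b+b\lhd a),\qquad \alpha_0(a,b)=\alpha'_0(a,b)+\beta\phi(b\lhd a)+\phi(a\circ b).$$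
   Context: All vector spaces are over $\mathbb{C}$. For a bilinear operation $\cdot$ on $V$, $V\cdot V$ denotes the linear span of all products. A left-symmetric algebra $(A,\circ)$ is a vector space with a bilinear product satisfying $(a\circ b)\circ c-a\circ(b\circ c)=(b\circ a)\circ c-b\circ(a\circ c)$. A left-symmetric conformal algebra is a $\mathbb{C}[\partial]$-module $R$ with a $\mathbb{C}$-bilinear map $R\times R\to R[\lambda]$, $(a,b)\mapsto a_\lambda b$, such that $\partial a_\lambda b=-\lambda a_\lambda b$, $a_\lambda\partial b=(\partial+\lambda)a_\lambda b$ (conformal sesquilinearity), and $(a_\lambda b)_{\lambda+\mu}c-a_\lambda(b_\mu c)=(b_\mu a)_{\lambda+\mu}c-b_\mu(a_\lambda c)$. A pre-Novikov algebra $(A,\lhd,\rhd)$ is a vector space with two bilinear operations such that for all $a,b,c\in A$: $a\rhd(b\rhd c)=(a\rhd b+a\lhd b)\rhd c+b\rhd(a\rhd c)-(b\rhd a+b\lhd a)\rhd c$; $a\rhd(b\lhd c)=(a\rhd b)\lhd c+b\lhd(a\lhd c+a\rhd c)-(b\lhd a)\lhd c$; $(a\lhd b+a\rhd b)\rhd c=(a\rhd c)\lhd b$; $(a\lhd b)\lhd c=(a\lhd c)\lhd b$. A pre-Gel'fand-Dorfman algebra $(A,\lhd,\rhd,\circ)$ is a vector space such that $(A,\lhd,\rhd)$ is a pre-Novikov algebra, $(A,\circ)$ is a left-symmetric algebra, and for all $a,b,c$: $c\lhd(a\circ b-b\circ a)-a\circ(c\lhd b)-(b\circ c)\lhd a=-b\circ(c\lhd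 a)-(a\circ c)\lhd b$; $(a\circ b-b\circ a)\rhd c+(a\lhd b+a\rhd b)\circ c=a\rhd(b\circ c)-b\circ(a\rhd c)+(a\circ c)\lhd b$. The quadratic left-symmetric conformal algebra corresponding to $(V,\lhd,\rhd,\circ)$ is the free $\mathbb{C}[\partial]$-module $R=\mathbb{C}[\partial]V=\mathbb{C}[\partial]\otimes V$ with $a_\lambda b=\partial(b\lhd a)+a\circ b+\lambda(a\rhd b+b\lhd a)$ for $a,b\in V$, extended by conformal sesquilinearity (this is a left-symmetric conformal algebra). Central extensions: a central extension of $R$ by $\mathbb{C}\mathfrak{c}_\beta$ is a left-symmetric conformal algebra structure on the $\mathbb{C}[\partial]$-module $\widehat{R}=R\oplus\mathbb{C}\mathfrak{c}_\beta$, $\partial\mathfrak{c}_\beta=\beta\mathfrak{c}_\beta$, with $\lambda$-product $\widehat{x_\lambda y}=x_\lambda y+\alpha_\lambda(x,y)\mathfrak{c}_\beta$ for $x,y\in R$ and all $\lambda$-products involving $\mathfrak{c}_\beta$ equal to zero, where $\alpha_\lambda:R\times R\to\mathbb{C}[\lambda]$ is $\mathbb{C}$-bilinear. By sesquilinearity, $\alpha_\lambda$ is determined by its restriction to $V\times V$. Two such central extensions $\widehat{R}_1,\widehat{R}_2$ (given by $\alpha_\lambda,\alpha'_\lambda$) are equivalent if there is a left-symmetric conformal algebra homomorphism $\varphi:\widehat{R}_1\to\widehat{R}_2$ restricting to the identity on $\mathbb{C}\mathfrak{c}_\beta$ and inducing the identity on $R$; in that case $\alpha_\lambda$ and $\alpha'_\lambda$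 are called equivalent. *)

theory Defs
  imports
    "HOL-Computational_Algebra.Polynomial"
    "HOL-Library.Product_Plus"
begin

section \<open>Linear algebra over the complex numbers\<close>

text \<open>
  A complex vector space is a type of class ab_group_add together with a scalar multiplication
  satisfying the predicate vector_space of HOL.
\<close>

definition bilinear_map ::
    "(complex \<Rightarrow> 'a \<Rightarrow> 'a) \<Rightarrow> (complex \<Rightarrow> 'b \<Rightarrow> 'b) \<Rightarrow> (complex \<Rightarrow> 'c \<Rightarrow> 'c)
      \<Rightarrow> ('a::ab_group_add \<Rightarrow> 'b::ab_group_add \<Rightarrow> 'c::ab_group_add) \<Rightarrow> bool" where
  "bilinear_map s1 s2 s3 f \<longleftrightarrow>
     (\<forall>x. Vector_Spaces.linear s2 s3 (\<lambda>y. f x y)) \<and>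
     (\<forall>y. Vector_Spaces.linear s1 s3 (\<lambda>x. f x y))"

text \<open>The linear span of all products is the whole space.\<close>

definition products_span ::
    "(complex \<Rightarrow> 'v \<Rightarrow> 'v) \<Rightarrow> ('v::ab_group_add \<Rightarrow> 'v \<Rightarrow> 'v) \<Rightarrow> bool" where
  "products_span scale m \<longleftrightarrow> module.span scale {m a b | a b. True} = UNIV"


section \<open>Pre-Gel'fand-Dorfman algebras\<close>

locale left_symmetric_algebra =
  vector_space scale
  for scale :: "complex \<Rightarrow> 'v::ab_group_add \<Rightarrow> 'v" +
  fixes m :: "'v \<Rightarrow> 'v \<Rightarrow> 'v" (infixl "\<odot>" 70)
  assumes bilinear_m: "bilinear_map scale scale scale (\<odot>)"
    and left_symmetric:
      "(a \<odot> b) \<odot> c - a \<odot> (b \<odot> c) = (b \<odot> a) \<odot> c - b \<odot> (a \<odot> c)"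

locale pre_Novikov_algebra =
  vector_space scale
  for scale :: "complex \<Rightarrow> 'v::ab_group_add \<Rightarrow> 'v" +
  fixes l :: "'v \<Rightarrow> 'v \<Rightarrow> 'v" (infixl "\<lhd>" 70)
    and r :: "'v \<Rightarrow> 'v \<Rightarrow> 'v" (infixl "\<rhd>" 70)
  assumes bilinear_l: "bilinear_map scale scale scale (\<lhd>)"
    and bilinear_r: "bilinear_map scale scale scale (\<rhd>)"
    and pN1: "a \<rhd> (b \<rhd> c) = (a \<rhd> b + a \<lhd> b) \<rhd> c + b \<rhd> (a \<rhd> c) - (b \<rhd> a + b \<lhd> a) \<rhd> c"
    and pN2: "a \<rhd> (b \<lhd> c) = (a \<rhd> b) \<lhd> c + b \<lhd> (a \<lhd> c + a \<rhd> c) - (b \<lhd> a) \<lhd> c"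
    and pN3: "(a \<lhd> b + a \<rhd> b) \<rhd> c = (a \<rhd> c) \<lhd> b"
    and pN4: "(a \<lhd> b) \<lhd> c = (a \<lhd> c) \<lhd> b"

locale pre_Gelfand_Dorfman_algebra =
  pre_Novikov_algebra scale l r + left_symmetric_algebra scale m
  for scale :: "complex \<Rightarrow> 'v::ab_group_add \<Rightarrow> 'v"
    and l :: "'v \<Rightarrow> 'v \<Rightarrow> 'v" (infixl "\<lhd>" 70)
    and r :: "'v \<Rightarrow> 'v \<Rightarrow> 'v" (infixl "\<rhd>" 70)
    and m :: "'v \<Rightarrow> 'v \<Rightarrow> 'v" (infixl "\<odot>" 70) +
  assumes pGD1:
      "c \<lhd> (a \<odot> b - b \<odot> a) - a \<odot> (c \<lhd> b) - (b \<odot> c) \<lhd> a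
         = - (b \<odot> (c \<lhd> a)) - (a \<odot> c) \<lhd> b"
    and pGD2:
      "(a \<odot> b - b \<odot> a) \<rhd> c + (a \<lhd> b + a \<rhd> b) \<odot> c
         = a \<rhd> (b \<odot> c) - b \<odot> (a \<rhd> c) + (a \<odot> c) \<lhd> b"


section \<open>Left-symmetric conformal algebras\<close>

text \<open>
  For an abelian group R, the type of polynomials over R represents R[x]; multiplication by x
  is \<open>pCons 0\<close>. In R[x][y], represented by polynomials whose coefficients are polynomials,
  multiplication by the outer variable y is \<open>pCons 0\<close> and multiplication by the inner variable x
  is \<open>map_poly (pCons 0)\<close>.

  \<open>poly_subst X f p\<close> sends \<open>p = \<Sum>i. r\<^sub>i x^i\<close> to \<open>\<Sum>i. X^i (f r\<^sub>i)\<close>: it applies f to the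
  coefficients of p and substitutes the operator X for the variable.
\<close>

definition poly_subst ::
    "('b \<Rightarrow> 'b) \<Rightarrow> ('a::zero \<Rightarrow> 'b::comm_monoid_add) \<Rightarrow> 'a poly \<Rightarrow> 'b" where
  "poly_subst X f p = (\<Sum>i\<le>degree p. (X ^^ i) (f (coeff p i)))"

text \<open>
  R[\<open>\<lambda>\<close>,\<open>\<mu>\<close>] is R[\<open>\<mu>\<close>][\<open>\<lambda>\<close>]: the outer variable is \<open>\<lambda>\<close>, the inner one is \<open>\<mu>\<close>.
\<close>

definition mult_lam :: "'r::zero poly poly \<Rightarrow> 'r poly poly" where
  "mult_lam = pCons 0"

definition mult_mu :: "'r::zero poly poly \<Rightarrow> 'r poly poly" where
  "mult_mu = map_poly (pCons 0)"

definition mult_lam_mu :: "'r::comm_monoid_add poly poly \<Rightarrow> 'r poly poly" where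
  "mult_lam_mu q = mult_lam q + mult_mu q"

definition const2 :: "'r::zero \<Rightarrow> 'r poly poly" where
  "const2 r = [:[:r:]:]"

text \<open>
  A C[\<open>\<partial>\<close>]-module is a complex vector space R with a linear endomorphism D. A \<open>\<lambda>\<close>-product takes
  values in R[\<open>\<lambda>\<close>]. The four terms of the last axiom are, in this order,
  \<open>(a\<^sub>\<lambda> b)\<close> with \<open>\<lambda> + \<mu>\<close> against c, \<open>a\<^sub>\<lambda> (b\<^sub>\<mu> c)\<close>, \<open>(b\<^sub>\<mu> a)\<close> with \<open>\<lambda> + \<mu>\<close> against c, and
  \<open>b\<^sub>\<mu> (a\<^sub>\<lambda> c)\<close>; they are elements of R[\<open>\<lambda>\<close>,\<open>\<mu>\<close>].
\<close>

locale left_symmetric_conformal_algebra =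
  vector_space scale
  for scale :: "complex \<Rightarrow> 'r::ab_group_add \<Rightarrow> 'r" +
  fixes D :: "'r \<Rightarrow> 'r"
    and lprod :: "'r \<Rightarrow> 'r \<Rightarrow> 'r poly"
  assumes linear_D: "Vector_Spaces.linear scale scale D"
    and bilinear_lprod: "bilinear_map scale scale (\<lambda>k. map_poly (scale k)) lprod"
    and sesquilinear_left: "lprod (D a) b = - pCons 0 (lprod a b)"
    and sesquilinear_right: "lprod a (D b) = map_poly D (lprod a b) + pCons 0 (lprod a b)"
    and conformal_left_symmetric:
      "poly_subst mult_lam (\<lambda>r. poly_subst mult_lam_mu const2 (lprod r c)) (lprod a b)
         - poly_subst mult_mu (\<lambda>r. poly_subst mult_lam const2 (lprod a r)) (lprod b c)
       = poly_subst mult_mu (\<lambda>r. poly_subst mult_lam_mu const2 (lprod r c)) (lprod b a)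
         - poly_subst mult_lam (\<lambda>r. poly_subst mult_mu const2 (lprod b r)) (lprod a c)"

definition lsca_hom ::
    "(complex \<Rightarrow> 'r \<Rightarrow> 'r) \<Rightarrow> ('r \<Rightarrow> 'r) \<Rightarrow> ('r \<Rightarrow> 'r \<Rightarrow> 'r poly)
      \<Rightarrow> (complex \<Rightarrow> 's \<Rightarrow> 's) \<Rightarrow> ('s \<Rightarrow> 's) \<Rightarrow> ('s \<Rightarrow> 's \<Rightarrow> 's poly)
      \<Rightarrow> ('r::ab_group_add \<Rightarrow> 's::ab_group_add) \<Rightarrow> bool" where
  "lsca_hom scale1 D1 lprod1 scale2 D2 lprod2 \<phi> \<longleftrightarrow>
     Vector_Spaces.linear scale1 scale2 \<phi> \<and>
     (\<forall>x. \<phi> (D1 x) = D2 (\<phi> x)) \<and>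
     (\<forall>x y. map_poly \<phi> (lprod1 x y) = lprod2 (\<phi> x) (\<phi> y))"


section \<open>The quadratic left-symmetric conformal algebra\<close>

text \<open>
  The free module C[\<open>\<partial>\<close>]V is the type of polynomials over V, with variable \<open>\<partial>\<close>; an element a of V
  is the constant polynomial [:a:]. Values of the \<open>\<lambda>\<close>-product are polynomials in \<open>\<lambda>\<close> (outer
  variable) whose coefficients are polynomials in \<open>\<partial>\<close> (inner variable).
\<close>

definition free_scale :: "(complex \<Rightarrow> 'v \<Rightarrow> 'v) \<Rightarrow> complex \<Rightarrow> 'v::zero poly \<Rightarrow> 'v poly" where
  "free_scale scale k = map_poly (scale k)"

definition free_D :: "'v::zero poly \<Rightarrow> 'v poly" where
  "free_D = pCons 0"

definition quad_base ::
    "('v \<Rightarrow> 'v \<Rightarrow> 'v) \<Rightarrow> ('v \<Rightarrow> 'v \<Rightarrow> 'v) \<Rightarrow> ('v \<Rightarrow> 'v \<Rightarrow> 'v)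
      \<Rightarrow> 'v::ab_group_add \<Rightarrow> 'v \<Rightarrow> 'v poly poly" where
  "quad_base l r m a b = [:[:m a b, l b a:], [:r a b + l b a:]:]"

text \<open>
  Extension by sesquilinearity: for \<open>f(\<partial>)a\<close> and \<open>g(\<partial>)b\<close> with a, b in V the \<open>\<lambda>\<close>-product is
  \<open>f(-\<lambda>) g(\<partial> + \<lambda>)\<close> applied to the \<open>\<lambda>\<close>-product of a and b.
\<close>

definition quad_lprod ::
    "('v \<Rightarrow> 'v \<Rightarrow> 'v) \<Rightarrow> ('v \<Rightarrow> 'v \<Rightarrow> 'v) \<Rightarrow> ('v \<Rightarrow> 'v \<Rightarrow> 'v)
      \<Rightarrow> 'v::ab_group_add poly \<Rightarrow> 'v poly \<Rightarrow> 'v poly poly" where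
  "quad_lprod l r m x y =
     poly_subst (\<lambda>q. - pCons 0 q)
       (\<lambda>a. poly_subst (\<lambda>q. map_poly free_D q + pCons 0 q) (\<lambda>b. quad_base l r m a b) y) x"

lemma quad_lprod_const: "quad_lprod l r m [:a:] [:b:] = quad_base l r m a b"
  by (simp add: quad_lprod_def poly_subst_def)


section \<open>Central extensions\<close>

text \<open>
  The extension of R by the one-dimensional module spanned by c, where D c = \<open>\<beta>\<close> c,
  is carried by pairs \<open>(x, z)\<close>, standing for \<open>x + z c\<close>.
\<close>

definition ext_scale ::
    "(complex \<Rightarrow> 'r \<Rightarrow> 'r) \<Rightarrow> complex \<Rightarrow> 'r \<times> complex \<Rightarrow> 'r \<times> complex" where
  "ext_scale scale k u = (scale k (fst u), k * snd u)"

definition ext_D :: "('r \<Rightarrow> 'r) \<Rightarrow> complex \<Rightarrow> 'r \<times> complex \<Rightarrow> 'r \<times> complex" where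
  "ext_D D \<beta> u = (D (fst u), \<beta> * snd u)"

definition ext_lprod ::
    "('r \<Rightarrow> 'r \<Rightarrow> 'r poly) \<Rightarrow> ('r \<Rightarrow> 'r \<Rightarrow> complex poly)
      \<Rightarrow> 'r::ab_group_add \<times> complex \<Rightarrow> 'r \<times> complex \<Rightarrow> ('r \<times> complex) poly" where
  "ext_lprod lprod \<alpha> u v =
     map_poly (\<lambda>x. (x, 0)) (lprod (fst u) (fst v)) +
     map_poly (\<lambda>z. (0, z)) (\<alpha> (fst u) (fst v))"

definition central_extension ::
    "(complex \<Rightarrow> 'r \<Rightarrow> 'r) \<Rightarrow> ('r \<Rightarrow> 'r) \<Rightarrow> ('r \<Rightarrow> 'r \<Rightarrow> 'r poly) \<Rightarrow> complex
      \<Rightarrow> ('r::ab_group_add \<Rightarrow> 'r \<Rightarrow> complex poly) \<Rightarrow> bool" where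
  "central_extension scale D lprod \<beta> \<alpha> \<longleftrightarrow>
     bilinear_map scale scale smult \<alpha> \<and>
     left_symmetric_conformal_algebra (ext_scale scale) (ext_D D \<beta>) (ext_lprod lprod \<alpha>)"

definition equivalent_extensions ::
    "(complex \<Rightarrow> 'r \<Rightarrow> 'r) \<Rightarrow> ('r \<Rightarrow> 'r) \<Rightarrow> ('r \<Rightarrow> 'r \<Rightarrow> 'r poly) \<Rightarrow> complex
      \<Rightarrow> ('r::ab_group_add \<Rightarrow> 'r \<Rightarrow> complex poly) \<Rightarrow> ('r \<Rightarrow> 'r \<Rightarrow> complex poly) \<Rightarrow> bool" where
  "equivalent_extensions scale D lprod \<beta> \<alpha> \<alpha>' \<longleftrightarrow>
     (\<exists>\<phi>. lsca_hom (ext_scale scale) (ext_D D \<beta>) (ext_lprod lprod \<alpha>)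
                   (ext_scale scale) (ext_D D \<beta>) (ext_lprod lprod \<alpha>') \<phi> \<and>
          (\<forall>z. \<phi> (0, z) = (0, z)) \<and>
          (\<forall>x z. fst (\<phi> (x, z)) = x))"

definition form_coeff ::
    "('v::zero poly \<Rightarrow> 'v poly \<Rightarrow> complex poly) \<Rightarrow> nat \<Rightarrow> 'v \<Rightarrow> 'v \<Rightarrow> complex" where
  "form_coeff \<alpha> i a b = coeff (\<alpha> [:a:] [:b:]) i"

end

theory Submission
  imports Defs
begin

text \<open>
  The central component of conformal left-symmetry in the extension is a polynomial identity in two
  variables (\<open>cocycle_polynomial\<close>), in which \<open>\<alpha>\<^sub>\<lambda>\<close> is a polynomial with bilinear
  coefficients \<open>\<alpha>\<^sub>n\<close>:

  \<open>\<lambda> \<alpha>\<^bsub>\<lambda>+\<mu>\<^esub>(a * b, c) - \<mu> \<alpha>\<^bsub>\<lambda>+\<mu>\<^esub>(b * a, c) + \<alpha>\<^bsub>\<lambda>+\<mu>\<^esub>(a \<odot> b - b \<odot> a, c)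
    = (\<beta> + \<lambda>) \<alpha>\<^sub>\<lambda>(a, c \<lhd> b) + \<alpha>\<^sub>\<lambda>(a, b \<odot> c) + \<mu> \<alpha>\<^sub>\<lambda>(a, b \<star> c)
      - (\<beta> + \<mu>) \<alpha>\<^sub>\<mu>(b, c \<lhd> a) - \<alpha>\<^sub>\<mu>(b, a \<odot> c) - \<lambda> \<alpha>\<^sub>\<mu>(b, a \<star> c).\<close>

  All relations between the \<open>\<alpha>\<^sub>i\<close> are coefficients of this identity. The bound on the degree comes
  from the monomials \<open>\<lambda>\<^sup>i\<mu>\<^sup>j\<close> with \<open>i, j \<ge> 2\<close>, on which the right-hand side is zero while the left-hand
  side is given by binomial coefficients. If \<open>n \<ge> 4\<close> and \<open>\<alpha>\<^sub>n\<^sub>+\<^sub>1 = 0\<close>, two of them are independent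
  relations between \<open>\<alpha>\<^sub>n(a * b, c)\<close> and \<open>\<alpha>\<^sub>n(b * a, c)\<close>, so both vanish. Then the other
  monomials show that \<open>\<alpha>\<^sub>n(a, \<cdot>)\<close> vanishes on all products \<open>\<lhd>\<close>, \<open>\<rhd>\<close> and \<open>\<star>\<close>, and
  \<open>\<alpha>\<^sub>n = 0\<close> since one of the four products spans V (\<open>form_coeff_descent\<close>). In finite dimension the
  degrees are bounded, so this descent has a starting point and reaches \<open>n = 4\<close>
  (\<open>form_coeff_eq_0\<close>).

  An equivalence of extensions is a shift \<open>(x, z) \<mapsto> (x, f x + z)\<close> by a linear map \<open>f\<close> on
  \<open>\<complex>[\<partial>]V\<close> with \<open>f (\<partial>x) = \<beta> f x\<close> (\<open>equivalent_extensions_iff_coboundary\<close>). Such a map is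
  determined by its restriction to V, and sesquilinear forms are determined by their values on V, so
  equivalence is the single condition that \<open>\<alpha>\<^sub>\<lambda>\<close> and \<open>\<alpha>'\<^sub>\<lambda>\<close> differ on V by
  \<open>\<beta> \<phi>(b \<lhd> a) + \<phi>(a \<odot> b) + \<lambda> \<phi>(a \<star> b)\<close> for a linear \<open>\<phi>\<close> (\<open>equivalent_iff\<close>).
\<close>

section \<open>Additive maps and substitution\<close>

lemma additive_map_poly:
  assumes "additive f"
  shows "additive (map_poly f)"
proof -
  interpret additive f by fact
  show ?thesis
    by (standard, rule poly_eqI) (simp add: coeff_map_poly zero add)
qed

lemma poly_map_poly:
  fixes f :: "'a::zero \<Rightarrow> 'k::comm_ring_1"
  assumes "f 0 = 0"
  shows "poly (map_poly f p) x = (\<Sum>i\<le>degree p. f (coeff p i) * x ^ i)"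
proof -
  have "degree (map_poly f p) \<le> degree p"
    by (rule degree_le) (simp add: coeff_map_poly assms coeff_eq_0)
  then have "(\<Sum>i\<le>degree (map_poly f p). coeff (map_poly f p) i * x ^ i)
      = (\<Sum>i\<le>degree p. coeff (map_poly f p) i * x ^ i)"
    by (intro sum.mono_neutral_left) (auto simp: coeff_eq_0)
  then show ?thesis
    by (simp add: poly_altdef coeff_map_poly assms)
qed

text \<open>
  An additive map into a commutative ring that turns the operator X into multiplication by x turns
  operator substitution into evaluation of an honest polynomial at x. This is how the conformal
  axioms, stated with operators on an abelian group, become identities in a ring.
\<close>

lemma poly_subst_transfer:
  fixes \<Phi> :: "'b::ab_group_add \<Rightarrow> 'k::comm_ring_1"
  assumes "additive \<Phi>" and X: "\<And>q. \<Phi> (X q) = x * \<Phi> q" and "\<Phi> (f 0) = 0"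
  shows "\<Phi> (poly_subst X f p) = poly (map_poly (\<lambda>r. \<Phi> (f r)) p) x"
proof -
  interpret additive \<Phi> by fact
  have "\<Phi> ((X ^^ i) q) = x ^ i * \<Phi> q" for i q
    by (induction i) (simp_all add: X mult.assoc)
  then show ?thesis
    by (simp add: poly_subst_def sum poly_map_poly assms(3) mult.commute)
qed

section \<open>Polynomials in two variables\<close>

text \<open>
  As in \<open>mult_lam\<close> and \<open>mult_mu\<close>, \<open>\<lambda>\<close> is the outer and \<open>\<mu>\<close> the inner variable, so that
  \<open>coeff (coeff q i) j\<close> is the coefficient of \<open>\<lambda>\<^sup>i\<mu>\<^sup>j\<close> in \<open>q\<close>.
\<close>

abbreviation lam :: "complex poly poly" where "lam \<equiv> [:0, 1:]"
abbreviation mu :: "complex poly poly" where "mu \<equiv> [:[:0, 1:]:]"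

definition at_poly :: "complex poly \<Rightarrow> complex poly poly \<Rightarrow> complex poly poly" where
  "at_poly p x = poly (map_poly const2 p) x"

lemma additive_const2: "additive (const2 :: 'a::ab_group_add \<Rightarrow> _)"
  by standard (simp add: const2_def)

lemma at_poly_0 [simp]: "at_poly 0 x = 0"
  by (simp add: at_poly_def)

lemma at_poly_pCons: "at_poly (pCons a p) x = const2 a + x * at_poly p x"
  by (simp add: at_poly_def map_poly_pCons additive.zero[OF additive_const2])

lemma at_poly_add: "at_poly (p + q) x = at_poly p x + at_poly q x"
  by (simp add: at_poly_def additive.add[OF additive_map_poly[OF additive_const2]])

lemma at_poly_minus: "at_poly (- p) x = - at_poly p x"
  by (simp add: at_poly_def additive.minus[OF additive_map_poly[OF additive_const2]])

lemma at_poly_smult: "at_poly (smult k p) x = const2 k * at_poly p x"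
  by (induction p) (simp_all add: at_poly_pCons algebra_simps, simp_all add: const2_def)

lemma coeff_lam_mult: "coeff (coeff (lam * q) i) j = (case i of 0 \<Rightarrow> 0 | Suc i' \<Rightarrow> coeff (coeff q i') j)"
  by (simp add: coeff_pCons split: nat.split)

lemma coeff_mu_mult: "coeff (coeff (mu * q) i) j = (case j of 0 \<Rightarrow> 0 | Suc j' \<Rightarrow> coeff (coeff q i) j')"
  by (simp add: coeff_pCons split: nat.split)

lemma coeff_const2: "coeff (coeff (const2 k) i) j = (if i = 0 \<and> j = 0 then k else 0)"
  by (simp add: const2_def coeff_pCons split: nat.split)

lemma coeff_const2_mult: "coeff (coeff (const2 k * q) i) j = k * coeff (coeff q i) j"
  by (simp add: const2_def)

lemma coeff_at_lam: "coeff (coeff (at_poly p lam) i) j = (if j = 0 then coeff p i else 0)"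
proof (induction p arbitrary: i)
  case (pCons a p)
  show ?case
    unfolding at_poly_pCons coeff_add coeff_lam_mult coeff_const2 pCons.IH
    by (simp add: coeff_pCons split: nat.split)
qed simp

lemma coeff_at_mu: "coeff (coeff (at_poly p mu) i) j = (if i = 0 then coeff p j else 0)"
proof (induction p arbitrary: j)
  case (pCons a p)
  show ?case
    unfolding at_poly_pCons coeff_add coeff_mu_mult coeff_const2 pCons.IH
    by (simp add: coeff_pCons split: nat.split)
qed simp

text \<open>
  The binomial theorem. The induction step is Pascal's rule: multiplication by \<open>\<lambda> + \<mu>\<close> adds
  the coefficients at \<open>(i - 1, j)\<close> and \<open>(i, j - 1)\<close>.
\<close>

lemma coeff_at_lam_mu:
  "coeff (coeff (at_poly p (lam + mu)) i) j = of_nat (i + j choose i) * coeff p (i + j)"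
proof (induction p arbitrary: i j)
  case (pCons a p)
  show ?case
    unfolding at_poly_pCons distrib_right coeff_add coeff_lam_mult coeff_mu_mult coeff_const2 pCons.IH
    by (auto simp: coeff_pCons algebra_simps split: nat.split)
qed simp

section \<open>The cocycle condition of a central extension\<close>

lemma linear_additive: "Vector_Spaces.linear s1 s2 f \<Longrightarrow> additive f"
  by (simp add: additive_def Vector_Spaces.linear_iff)

lemma bilinear_additive:
  assumes "bilinear_map s1 s2 s3 f"
  shows "additive (f x)" and "additive (\<lambda>x. f x y)"
  using assms by (auto simp: bilinear_map_def intro: linear_additive)

lemma map_poly_snd_ext_lprod:
  fixes g :: "complex \<Rightarrow> 'b::comm_monoid_add"
  assumes "g 0 = 0"
  shows "map_poly (\<lambda>u. g (snd u)) (ext_lprod lprod \<alpha> u v) = map_poly g (\<alpha> (fst u) (fst v))"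
  by (rule poly_eqI) (simp add: ext_lprod_def coeff_map_poly assms flip: zero_prod_def)

lemma map_poly_fst_ext_lprod:
  fixes g :: "'r::ab_group_add \<Rightarrow> 'b::comm_monoid_add"
  assumes "g 0 = 0"
  shows "map_poly (\<lambda>u. g (fst u)) (ext_lprod lprod \<alpha> u v) = map_poly g (lprod (fst u) (fst v))"
  by (rule poly_eqI) (simp add: ext_lprod_def coeff_map_poly assms flip: zero_prod_def)

text \<open>
  Sesquilinearity in the extension holds in each component separately. For the central component,
  \<open>\<partial>\<close> acts on the central element as \<open>\<beta>\<close>; the component in R gives back sesquilinearity of
  the given \<open>\<lambda>\<close>-product.
\<close>

lemma central_extension_sesquilinear:
  assumes "central_extension scale D lprod \<beta> \<alpha>"
  shows "\<alpha> (D x) y = - pCons 0 (\<alpha> x y)"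
    and "\<alpha> x (D y) = smult \<beta> (\<alpha> x y) + pCons 0 (\<alpha> x y)"
    and "lprod (D x) y = - pCons 0 (lprod x y)"
    and "lprod x (D y) = map_poly D (lprod x y) + pCons 0 (lprod x y)"
proof -
  let ?P = "ext_lprod lprod \<alpha>"
  interpret E: left_symmetric_conformal_algebra "ext_scale scale" "ext_D D \<beta>" "?P"
    using assms by (simp add: central_extension_def)
  interpret D: additive "ext_D D \<beta>"
    using E.linear_D by (rule linear_additive)
  have S: "additive (snd :: 'a \<times> complex \<Rightarrow> complex)" and F: "additive (fst :: 'a \<times> complex \<Rightarrow> 'a)"
    by (simp_all add: additive_def)
  note S = additive_map_poly[OF S] and F = additive_map_poly[OF F]
  have snd: "map_poly snd (?P (x, 0) (y, 0)) = \<alpha> x y" for x y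
    using map_poly_snd_ext_lprod[of "\<lambda>x. x" lprod \<alpha> "(x, 0)" "(y, 0)"] by simp
  have fst: "map_poly fst (?P (x, 0) (y, 0)) = lprod x y" for x y
    using map_poly_fst_ext_lprod[of "\<lambda>x. x" lprod \<alpha> "(x, 0)" "(y, 0)"] by simp
  have D: "ext_D D \<beta> (x, 0) = (D x, 0)" for x
    by (simp add: ext_D_def)
  have D0: "D 0 = 0"
    using D.zero by (simp add: ext_D_def zero_prod_def)
  have *: "map_poly snd (map_poly (ext_D D \<beta>) q) = smult \<beta> (map_poly snd q)"
    "map_poly fst (map_poly (ext_D D \<beta>) q) = map_poly D (map_poly fst q)" for q
    by (rule poly_eqI; simp add: coeff_map_poly D.zero D0; simp add: ext_D_def)+
  note left = E.sesquilinear_left[of "(x, 0)" "(y, 0)", unfolded D]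
  note right = E.sesquilinear_right[of "(x, 0)" "(y, 0)", unfolded D]
  show "\<alpha> (D x) y = - pCons 0 (\<alpha> x y)"
    using arg_cong[OF left, of "map_poly snd"]
    by (simp add: additive.minus[OF S] map_poly_pCons snd)
  show "lprod (D x) y = - pCons 0 (lprod x y)"
    using arg_cong[OF left, of "map_poly fst"]
    by (simp add: additive.minus[OF F] map_poly_pCons fst)
  show "\<alpha> x (D y) = smult \<beta> (\<alpha> x y) + pCons 0 (\<alpha> x y)"
    using arg_cong[OF right, of "map_poly snd"]
    by (simp add: additive.add[OF S] map_poly_pCons snd *)
  show "lprod x (D y) = map_poly D (lprod x y) + pCons 0 (lprod x y)"
    using arg_cong[OF right, of "map_poly fst"]
    by (simp add: additive.add[OF F] map_poly_pCons fst *)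
qed

lemma central_extension_biadditive:
  assumes "central_extension scale D lprod \<beta> \<alpha>"
  shows "additive (\<alpha> x)" and "additive (\<lambda>x. \<alpha> x y)"
    and "additive (lprod x)" and "additive (\<lambda>x. lprod x y)"
proof -
  let ?P = "ext_lprod lprod \<alpha>"
  interpret E: left_symmetric_conformal_algebra "ext_scale scale" "ext_D D \<beta>" "?P"
    using assms by (simp add: central_extension_def)
  show "additive (\<alpha> x)" "additive (\<lambda>x. \<alpha> x y)"
    using assms by (auto simp: central_extension_def intro: bilinear_additive)
  have F: "additive (fst :: 'a \<times> complex \<Rightarrow> 'a)"
    by (simp add: additive_def)
  note F = additive_map_poly[OF F]
  have fst: "lprod x y = map_poly fst (?P (x, 0) (y, 0))" for x y
    using map_poly_fst_ext_lprod[of "\<lambda>x. x" lprod \<alpha> "(x, 0)" "(y, 0)"] by simp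
  have "?P (x, 0) (y + z, 0) = ?P (x, 0) (y, 0) + ?P (x, 0) (z, 0)"
    "?P (y + z, 0) (x, 0) = ?P (y, 0) (x, 0) + ?P (z, 0) (x, 0)" for x y z
    using additive.add[OF bilinear_additive(1)[OF E.bilinear_lprod], of "(x, 0)" "(y, 0)" "(z, 0)"]
      additive.add[OF bilinear_additive(2)[OF E.bilinear_lprod], of "(y, 0)" "(z, 0)" "(x, 0)"]
    by simp_all
  then show "additive (lprod x)" "additive (\<lambda>x. lprod x y)"
    by (simp_all add: additive_def fst additive.add[OF F])
qed

text \<open>
  The central component of conformal left-symmetry. Products with the central element vanish, so in
  an iterated product only the R-component of the product formed first is multiplied again, and the
  second multiplication contributes the form: each of the four terms applies the form to the
  coefficients of a \<open>\<lambda>\<close>-product in R.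
\<close>

lemma central_extension_cocycle:
  assumes "central_extension scale D lprod \<beta> \<alpha>"
  shows "poly (map_poly (\<lambda>x. at_poly (\<alpha> x c) (lam + mu)) (lprod a b)) lam
       - poly (map_poly (\<lambda>x. at_poly (\<alpha> a x) lam) (lprod b c)) mu
       = poly (map_poly (\<lambda>x. at_poly (\<alpha> x c) (lam + mu)) (lprod b a)) mu
       - poly (map_poly (\<lambda>x. at_poly (\<alpha> b x) mu) (lprod a c)) lam"
proof -
  let ?P = "ext_lprod lprod \<alpha>"
  interpret E: left_symmetric_conformal_algebra "ext_scale scale" "ext_D D \<beta>" "?P"
    using assms by (simp add: central_extension_def)
  note add = central_extension_biadditive[OF assms]
  define \<Phi> :: "('a \<times> complex) poly poly \<Rightarrow> complex poly poly"
    where "\<Phi> = map_poly (map_poly snd)"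
  have \<Phi>: "additive \<Phi>"
    unfolding \<Phi>_def by (intro additive_map_poly) (simp add: additive_def)
  have const2: "\<Phi> (const2 u) = const2 (snd u)" for u
    by (simp add: \<Phi>_def const2_def map_poly_pCons)
  have lam: "\<Phi> (mult_lam q) = lam * \<Phi> q" for q
    by (simp add: \<Phi>_def mult_lam_def map_poly_pCons)
  have mu: "\<Phi> (mult_mu q) = mu * \<Phi> q" for q
    by (rule poly_eqI) (simp add: \<Phi>_def mult_mu_def coeff_map_poly map_poly_pCons)
  have lam_mu: "\<Phi> (mult_lam_mu q) = (lam + mu) * \<Phi> q" for q
    unfolding mult_lam_mu_def additive.add[OF \<Phi>] lam mu by (rule distrib_right[symmetric])
  \<comment> \<open>Multiplying a product once more: the central component of the result is the form.\<close>
  have second_product: "\<Phi> (poly_subst X const2 (?P u v)) = at_poly (\<alpha> (fst u) (fst v)) x"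
    if "\<And>q. \<Phi> (X q) = x * \<Phi> q" for X x u v
  proof -
    have "\<Phi> (poly_subst X const2 (?P u v)) = poly (map_poly (\<lambda>r. const2 (snd r)) (?P u v)) x"
      unfolding const2[symmetric]
      by (rule poly_subst_transfer[OF \<Phi> that]) (simp add: const2, simp add: const2_def)
    then show ?thesis
      by (simp add: map_poly_snd_ext_lprod at_poly_def additive.zero[OF additive_const2])
  qed
  \<comment> \<open>The product formed first: only its R-component is multiplied again, so \<open>f\<close> factors
    through \<open>fst\<close>.\<close>
  have first_product: "\<Phi> (poly_subst X f (?P u v)) = poly (map_poly g (lprod (fst u) (fst v))) x"
    if "\<And>q. \<Phi> (X q) = x * \<Phi> q" "\<And>r. \<Phi> (f r) = g (fst r)" "g 0 = 0" for X x f g u v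
  proof -
    have "\<Phi> (poly_subst X f (?P u v)) = poly (map_poly (\<lambda>r. \<Phi> (f r)) (?P u v)) x"
      by (rule poly_subst_transfer[OF \<Phi> that(1)]) (simp add: that)
    then show ?thesis
      by (simp add: that map_poly_fst_ext_lprod)
  qed
  note zero = additive.zero[OF add(1)] additive.zero[OF add(2)]
  note eq = E.conformal_left_symmetric[where a = "(a, 0)" and b = "(b, 0)" and c = "(c, 0)",
      THEN arg_cong[of _ _ \<Phi>], unfolded additive.diff[OF \<Phi>]]
  have "\<Phi> (poly_subst mult_lam (\<lambda>r. poly_subst mult_lam_mu const2 (?P r (c, 0))) (?P (a, 0) (b, 0)))
      = poly (map_poly (\<lambda>x. at_poly (\<alpha> x c) (lam + mu)) (lprod a b)) lam"
    by (rule first_product[OF lam, THEN trans]) (simp_all add: second_product[OF lam_mu] zero)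
  moreover have "\<Phi> (poly_subst mult_mu (\<lambda>r. poly_subst mult_lam const2 (?P (a, 0) r)) (?P (b, 0) (c, 0)))
      = poly (map_poly (\<lambda>x. at_poly (\<alpha> a x) lam) (lprod b c)) mu"
    by (rule first_product[OF mu, THEN trans]) (simp_all add: second_product[OF lam] zero)
  moreover have "\<Phi> (poly_subst mult_mu (\<lambda>r. poly_subst mult_lam_mu const2 (?P r (c, 0))) (?P (b, 0) (a, 0)))
      = poly (map_poly (\<lambda>x. at_poly (\<alpha> x c) (lam + mu)) (lprod b a)) mu"
    by (rule first_product[OF mu, THEN trans]) (simp_all add: second_product[OF lam_mu] zero)
  moreover have "\<Phi> (poly_subst mult_lam (\<lambda>r. poly_subst mult_mu const2 (?P (b, 0) r)) (?P (a, 0) (c, 0)))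
      = poly (map_poly (\<lambda>x. at_poly (\<alpha> b x) mu) (lprod a c)) lam"
    by (rule first_product[OF lam, THEN trans]) (simp_all add: second_product[OF mu] zero)
  ultimately show ?thesis
    using eq by simp
qed

section \<open>The cocycle condition over a quadratic conformal algebra\<close>

lemma linear_zero_if_products_span:
  assumes "products_span scale f" and "Vector_Spaces.linear scale s2 g"
    and "\<And>a b. g (f a b) = 0"
  shows "g x = 0"
proof -
  interpret Vector_Spaces.linear scale s2 g by fact
  have "x \<in> vs1.span {f a b | a b. True}"
    using assms(1) by (simp add: products_span_def)
  then show ?thesis
    by (rule eq_0_on_span[rotated]) (use assms(3) in auto)
qed

lemma vector_space_complex: "vector_space ((*) :: complex \<Rightarrow> complex \<Rightarrow> complex)"
  by standard (simp_all add: algebra_simps)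

locale quadratic_central_extension =
  vector_space scale
  for scale :: "complex \<Rightarrow> 'v::ab_group_add \<Rightarrow> 'v"
    and l :: "'v \<Rightarrow> 'v \<Rightarrow> 'v" (infixl "\<lhd>" 70)
    and r :: "'v \<Rightarrow> 'v \<Rightarrow> 'v" (infixl "\<rhd>" 70)
    and m :: "'v \<Rightarrow> 'v \<Rightarrow> 'v" (infixl "\<odot>" 70)
    and \<beta> :: complex
    and \<alpha> :: "'v poly \<Rightarrow> 'v poly \<Rightarrow> complex poly" +
  assumes extension:
    "central_extension (free_scale scale) free_D (quad_lprod (\<lhd>) (\<rhd>) (\<odot>)) \<beta> \<alpha>"
begin

abbreviation ast (infixl "\<^bold>*" 70) where "a \<^bold>* b \<equiv> a \<rhd> b + a \<lhd> b"
abbreviation star (infixl "\<star>" 70) where "a \<star> b \<equiv> a \<rhd> b + b \<lhd> a"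
abbreviation A where "A \<equiv> form_coeff \<alpha>"

lemmas sesquilinear = central_extension_sesquilinear[OF extension]
lemmas \<alpha>_add = additive.add[OF central_extension_biadditive(1)[OF extension]]
  additive.add[OF central_extension_biadditive(2)[OF extension]]

lemma \<alpha>_add_const:
  "\<alpha> [:a + a':] y = \<alpha> [:a:] y + \<alpha> [:a':] y"
  "\<alpha> x [:b + b':] = \<alpha> x [:b:] + \<alpha> x [:b':]"
  using \<alpha>_add(2)[of "[:a:]" "[:a':]"] \<alpha>_add(1)[of _ "[:b:]" "[:b':]"] by simp_all

lemma bilinear_form_coeff: "bilinear_map scale scale (*) (A n)"
proof -
  have const: "free_scale scale k [:a:] = [:scale k a:]" for k a
    by (simp add: free_scale_def map_poly_pCons)
  have "bilinear_map (free_scale scale) (free_scale scale) smult \<alpha>"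
    using extension by (simp add: central_extension_def)
  then have "\<alpha> (free_scale scale k x) y = smult k (\<alpha> x y)" "\<alpha> x (free_scale scale k y) = smult k (\<alpha> x y)"
    for k x y
    by (auto simp: bilinear_map_def Vector_Spaces.linear_iff)
  note scale = this(1)[of _ "[:_:]", unfolded const] this(2)[of _ _ "[:_:]", unfolded const]
  show ?thesis
    by (simp add: bilinear_map_def Vector_Spaces.linear_iff vector_space_complex vector_space_axioms
        form_coeff_def scale \<alpha>_add_const)
qed

lemma linear_form_coeff:
  "Vector_Spaces.linear scale (*) (A n a)" "Vector_Spaces.linear scale (*) (\<lambda>a. A n a b)"
  using bilinear_form_coeff by (auto simp: bilinear_map_def)

lemmas form_coeff_add = additive.add[OF linear_additive[OF linear_form_coeff(1)]]
  additive.add[OF linear_additive[OF linear_form_coeff(2)]]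

lemma poly_map_quad_base:
  assumes "additive h"
  shows "poly (map_poly h (quad_lprod (\<lhd>) (\<rhd>) (\<odot>) [:a:] [:b:])) x
    = h [:a \<odot> b:] + h (free_D [:b \<lhd> a:]) + x * (h [:a \<rhd> b:] + h [:b \<lhd> a:])"
proof -
  interpret additive h by fact
  have "[:a \<odot> b, b \<lhd> a:] = [:a \<odot> b:] + free_D [:b \<lhd> a:]" and "[:a \<star> b:] = [:a \<rhd> b:] + [:b \<lhd> a:]"
    by (simp_all add: free_D_def)
  then show ?thesis
    by (simp only: quad_lprod_const quad_base_def map_poly_pCons zero map_poly_0 poly_pCons poly_0 add)
       simp
qed

text \<open>
  The cocycle condition for generators. In the terms with \<open>\<lambda> + \<mu>\<close>, the derivative in
  \<open>\<partial>(b \<lhd> a)\<close> contributes the factor \<open>-(\<lambda> + \<mu>)\<close>, which together with the factor \<open>\<lambda>\<close> of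
  \<open>a \<star> b\<close> leaves \<open>b \<lhd> a\<close> with factor \<open>-\<mu>\<close> and \<open>a \<rhd> b\<close> with factor \<open>\<lambda>\<close>. Subtracting the term
  with \<open>a\<close>, \<open>b\<close> and \<open>\<lambda>\<close>, \<open>\<mu>\<close> exchanged completes these to \<open>b * a\<close> and \<open>a * b\<close>. In the other
  terms \<open>\<partial>\<close> stands in the second argument and acts as \<open>\<beta> + \<lambda>\<close> or \<open>\<beta> + \<mu>\<close>.
\<close>

lemma cocycle_polynomial:
  fixes S P Q
  defines "S \<equiv> \<lambda>x y. at_poly (\<alpha> [:x:] [:y:]) (lam + mu)"
    and "P \<equiv> \<lambda>x y. at_poly (\<alpha> [:x:] [:y:]) lam"
    and "Q \<equiv> \<lambda>x y. at_poly (\<alpha> [:x:] [:y:]) mu"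
  shows "lam * S (a \<^bold>* b) c - mu * S (b \<^bold>* a) c + (S (a \<odot> b) c - S (b \<odot> a) c)
    = const2 \<beta> * P a (c \<lhd> b) + lam * P a (c \<lhd> b) + P a (b \<odot> c) + mu * P a (b \<star> c)
    - (const2 \<beta> * Q b (c \<lhd> a) + mu * Q b (c \<lhd> a) + Q b (a \<odot> c) + lam * Q b (a \<star> c))"
proof -
  have left: "additive (\<lambda>x. at_poly (\<alpha> x y) z)" and right: "additive (\<lambda>y. at_poly (\<alpha> x y) z)" for x y z
    by (simp_all add: additive_def \<alpha>_add at_poly_add)
  \<comment> \<open>Names for the variables keep multiplication by them from being computed, so that the identity
    is one of commutative rings.\<close>
  define L where "L = lam"
  define M where "M = mu"
  have D: "at_poly (\<alpha> (free_D x) y) z = - (z * at_poly (\<alpha> x y) z)"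
    "at_poly (\<alpha> x (free_D y)) z = const2 \<beta> * at_poly (\<alpha> x y) z + z * at_poly (\<alpha> x y) z" for x y z
    by (simp_all add: sesquilinear at_poly_add at_poly_smult at_poly_minus at_poly_pCons
        additive.zero[OF additive_const2])
  show ?thesis
    using central_extension_cocycle[OF extension, where a = "[:a:]" and b = "[:b:]" and c = "[:c:]"]
    unfolding poly_map_quad_base[OF left] poly_map_quad_base[OF right]
    unfolding assms \<alpha>_add_const at_poly_add D L_def[symmetric] M_def[symmetric]
    by (simp add: algebra_simps)
qed

text \<open>
  The coefficient of \<open>\<lambda>\<^sup>i\<mu>\<^sup>j\<close>. Every term on the right has degree at most 1 in \<open>\<lambda>\<close> or in \<open>\<mu>\<close>, so the side
  vanishes for \<open>i, j \<ge> 2\<close>; all consequences below are read off at \<open>j = 0\<close>, at \<open>j = 1\<close>, and in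
  that mixed range.
\<close>

lemma cocycle_coeff:
  "(case i of 0 \<Rightarrow> 0 | Suc i' \<Rightarrow> of_nat (i' + j choose i') * A (i' + j) (a \<^bold>* b) c)
    - (case j of 0 \<Rightarrow> 0 | Suc j' \<Rightarrow> of_nat (i + j' choose i) * A (i + j') (b \<^bold>* a) c)
    + of_nat (i + j choose i) * (A (i + j) (a \<odot> b) c - A (i + j) (b \<odot> a) c)
  = (if j = 0 then \<beta> * A i a (c \<lhd> b) + (case i of 0 \<Rightarrow> 0 | Suc i' \<Rightarrow> A i' a (c \<lhd> b)) + A i a (b \<odot> c) else 0)
    + (if j = 1 then A i a (b \<star> c) else 0)
    - (if i = 0 then \<beta> * A j b (c \<lhd> a) + (case j of 0 \<Rightarrow> 0 | Suc j' \<Rightarrow> A j' b (c \<lhd> a)) + A j b (a \<odot> c) else 0)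
    - (if i = 1 then A j b (a \<star> c) else 0)"
  using arg_cong[OF cocycle_polynomial[of a b c], of "\<lambda>q. coeff (coeff q i) j"]
  unfolding coeff_add coeff_diff coeff_lam_mult coeff_mu_mult coeff_const2_mult
    coeff_at_lam coeff_at_mu coeff_at_lam_mu form_coeff_def
  by (cases i; cases j) (auto simp: right_diff_distrib)

lemma cocycle_pure:
  "A n (a \<^bold>* b) c + A (Suc n) (a \<odot> b) c - A (Suc n) (b \<odot> a) c
    = A n a (c \<lhd> b) + \<beta> * A (Suc n) a (c \<lhd> b) + A (Suc n) a (b \<odot> c)
      - (if n = 0 then A 0 b (a \<star> c) else 0)"
  using cocycle_coeff[where i = "Suc n" and j = 0 and a = a and b = b and c = c]
  by (cases "n = 0") (simp_all add: algebra_simps)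

lemma cocycle_linear:
  "of_nat (Suc n) * A (Suc n) (a \<^bold>* b) c - A (Suc n) (b \<^bold>* a) c
      + of_nat (Suc (Suc n)) * (A (Suc (Suc n)) (a \<odot> b) c - A (Suc (Suc n)) (b \<odot> a) c)
    = A (Suc n) a (b \<star> c) - (if n = 0 then A 1 b (a \<star> c) else 0)"
  using cocycle_coeff[where i = "Suc n" and j = 1 and a = a and b = b and c = c] by simp

lemma cocycle_mixed:
  "of_nat (Suc i + j choose i) * A (Suc i + j) (a \<^bold>* b) c
    - of_nat (Suc i + j choose Suc i) * A (Suc i + j) (b \<^bold>* a) c
    + of_nat (Suc i + Suc j choose Suc i) * (A (Suc (Suc i + j)) (a \<odot> b) c - A (Suc (Suc i + j)) (b \<odot> a) c) = 0"
  if "0 < i" "0 < j"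
  using cocycle_coeff[where i = "Suc i" and j = "Suc j" and a = a and b = b and c = c] that by simp

text \<open>
  If the component of degree \<open>n + 1\<close> vanishes, the mixed coefficients of total degree \<open>n + 1\<close> are
  homogeneous linear relations between \<open>A n (a * b) c\<close> and \<open>A n (b * a) c\<close>. For \<open>n = 3\<close> there is
  only one, saying that the two values are equal; for \<open>n \<ge> 4\<close> the positions \<open>(2, n - 1)\<close> and \<open>(n - 1, 2)\<close> give
  two independent ones, so both values are zero. The coefficients of \<open>\<lambda>\<^sup>n\<^sup>+\<^sup>1\<close> and \<open>\<lambda>\<^sup>n\<mu>\<close> then kill
  \<open>A n a (c \<lhd> b)\<close>, \<open>A n a (b \<star> c)\<close> and hence \<open>A n a (b \<rhd> c)\<close>, so whichever product spans
  the space forces \<open>A n = 0\<close>.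
\<close>

lemma form_coeff_descent:
  assumes n: "4 \<le> n" and top: "\<And>a b. A (Suc n) a b = 0"
    and span: "products_span scale (\<^bold>*) \<or> products_span scale (\<star>) \<or>
         products_span scale (\<lhd>) \<or> products_span scale (\<rhd>)"
  shows "A n a b = 0"
proof -
  define k where "k = n - 2"
  have k: "n = Suc (Suc k)" "2 \<le> k"
    using n by (auto simp: k_def)
  let ?p = "of_nat n :: complex" and ?q = "of_nat (n choose 2) :: complex"
  have "n choose k = n choose 2" "n choose Suc k = n"
    using binomial_symmetric[of 2 n] binomial_symmetric[of 1 n] k by simp_all
  then have 1: "?p * A n (a \<^bold>* b) c = ?q * A n (b \<^bold>* a) c"
    and 2: "?q * A n (a \<^bold>* b) c = ?p * A n (b \<^bold>* a) c" for a b c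
    using cocycle_mixed[of 1 k a b c] cocycle_mixed[of k 1 a b c] k
    by (simp_all add: top[unfolded k] numeral_2_eq_2)
  \<comment> \<open>Independence of the two relations amounts to \<open>n\<^sup>2 \<noteq> (n choose 2)\<^sup>2\<close>.\<close>
  obtain d where "n = 4 + d"
    using n le_Suc_ex by blast
  then have "2 * n + 2 \<le> n * (n - 1)"
    by (simp add: algebra_simps)
  then have "n < n choose 2"
    unfolding choose_two by linarith
  then have "n * n < (n choose 2) * (n choose 2)"
    using mult_strict_mono[of n "n choose 2" n "n choose 2"] by linarith
  then have pq: "?p * ?p \<noteq> ?q * ?q"
    by (metis of_nat_eq_iff of_nat_mult less_irrefl)
  have ast: "A n (a \<^bold>* b) c = 0" for a b c
  proof -
    have "?p * ?p * A n (a \<^bold>* b) c = ?q * ?q * A n (a \<^bold>* b) c"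
      using 1[of a b c] 2[of a b c] by (simp add: mult.assoc mult.left_commute)
    with pq show ?thesis by simp
  qed
  have l: "A n a (c \<lhd> b) = 0" for a b c
    using cocycle_pure[of n a b c] n by (simp add: top ast)
  have star: "A n a (b \<star> c) = 0" for a b c
    using cocycle_linear[of "Suc k" a b c] k by (simp add: top[unfolded k] ast[unfolded k])
  have r: "A n a (b \<rhd> c) = 0" for a b c
    using star[of a b c] l by (simp add: form_coeff_add)
  show ?thesis
    using span linear_zero_if_products_span[OF _ linear_form_coeff(2)] ast
      linear_zero_if_products_span[OF _ linear_form_coeff(1)] star l r
    by blast
qed

text \<open>
  Each value of the form is a polynomial, but only finite dimension bounds the degrees of all of them
  at once: the maximum over pairs of basis vectors is a bound.
\<close>

lemma form_coeff_bounded: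
  assumes "finite_dimensional_vector_space scale B"
  obtains N where "\<And>n a b. N < n \<Longrightarrow> A n a b = 0"
proof
  interpret B: finite_dimensional_vector_space scale B by fact
  let ?N = "Max (insert 0 ((\<lambda>(a, b). degree (\<alpha> [:a:] [:b:])) ` (B \<times> B)))"
  have fin: "finite ((\<lambda>(a, b). degree (\<alpha> [:a:] [:b:])) ` (B \<times> B))"
    using B.finite_Basis by simp
  fix n a b
  assume n: "?N < n"
  have basis: "A n a b = 0" if "a \<in> B" "b \<in> B" for a b
  proof -
    have "degree (\<alpha> [:a:] [:b:]) < n"
      using n fin that by (subst (asm) Max_less_iff) auto
    then show ?thesis
      by (simp add: form_coeff_def coeff_eq_0)
  qed
  have right: "A n a b = 0" if "a \<in> B" for a b
  proof -
    interpret Vector_Spaces.linear scale "(*)" "A n a" by (rule linear_form_coeff)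
    show ?thesis
      by (rule eq_0_on_span[of B]) (use basis that B.span_Basis in auto)
  qed
  interpret Vector_Spaces.linear scale "(*)" "\<lambda>a. A n a b" by (rule linear_form_coeff)
  show "A n a b = 0"
    by (rule eq_0_on_span[of B]) (use right B.span_Basis in auto)
qed

lemma form_coeff_eq_0:
  assumes "finite_dimensional_vector_space scale B"
    and span: "products_span scale (\<^bold>*) \<or> products_span scale (\<star>) \<or>
         products_span scale (\<lhd>) \<or> products_span scale (\<rhd>)"
    and "4 \<le> n"
  shows "A n a b = 0"
proof -
  obtain N where N: "\<And>n a b. N < n \<Longrightarrow> A n a b = 0"
    using form_coeff_bounded[OF assms(1)] by blast
  have "n \<le> max n (Suc N)" by simp
  then have "\<forall>a b. A n a b = 0"
  proof (induction rule: inc_induct)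
    case base
    show ?case using N[of "max n (Suc N)"] by simp
  next
    case (step k)
    then show ?case using form_coeff_descent[OF _ _ span, of k] assms(3) by auto
  qed
  then show ?thesis by simp
qed

lemma form_eq_sum_monom:
  assumes "\<And>n a b. 4 \<le> n \<Longrightarrow> A n a b = 0"
  shows "\<alpha> [:a:] [:b:] = (\<Sum>i\<le>3. monom (A i a b) i)"
proof (rule poly_eqI)
  fix n
  have "coeff (\<Sum>i\<le>3. monom (A i a b) i) n = (\<Sum>i\<le>3. if n = i then A i a b else 0)"
    by (auto simp: coeff_sum intro: sum.cong)
  then show "coeff (\<alpha> [:a:] [:b:]) n = coeff (\<Sum>i\<le>3. monom (A i a b) i) n"
    using assms[of n a b] by (simp add: form_coeff_def)
qed

lemma cocycle_relations:
  assumes "\<And>n a b. 4 \<le> n \<Longrightarrow> A n a b = 0"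
  shows "A 3 (a \<^bold>* b) c = A 3 (b \<^bold>* a) c"
    and "A 3 (b \<^bold>* a) c = A 3 a (c \<lhd> b)"
    and "A 3 a (c \<lhd> b) = A 3 b (a \<rhd> c)"
    and "A 2 (a \<^bold>* b) c - A 2 a (c \<lhd> b) - \<beta> * A 3 a (c \<lhd> b) - A 3 a (b \<odot> c)
          = A 3 (b \<odot> a) c - A 3 (a \<odot> b) c"
    and "2 * A 2 (a \<^bold>* b) c - A 2 (b \<^bold>* a) c - A 2 a (b \<star> c)
          = 3 * A 3 (b \<odot> a) c - 3 * A 3 (a \<odot> b) c"
    and "A 1 (a \<^bold>* b) c - A 1 a (c \<lhd> b) - \<beta> * A 2 a (c \<lhd> b) - A 2 a (b \<odot> c)
          = A 2 (b \<odot> a) c - A 2 (a \<odot> b) c"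
    and "A 1 (a \<^bold>* b) c - A 1 (b \<^bold>* a) c - A 1 a (b \<star> c) + A 1 b (a \<star> c)
          = 2 * A 2 (b \<odot> a) c - 2 * A 2 (a \<odot> b) c"
    and "A 0 (a \<^bold>* b) c - A 0 a (c \<lhd> b) + A 0 b (a \<star> c) - \<beta> * A 1 a (c \<lhd> b) - A 1 a (b \<odot> c)
          = A 1 (b \<odot> a) c - A 1 (a \<odot> b) c"
    and "A 0 (a \<odot> b) c - \<beta> * A 0 a (c \<lhd> b) - A 0 a (b \<odot> c)
          = A 0 (b \<odot> a) c - \<beta> * A 0 b (c \<lhd> a) - A 0 b (a \<odot> c)"
proof -
  have sym: "A 3 (a \<^bold>* b) c = A 3 (b \<^bold>* a) c" for a b c
    using cocycle_mixed[of 1 1 a b c] assms[of 4] by (simp add: numeral_eq_Suc)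
  have pure: "A 3 (a \<^bold>* b) c = A 3 a (c \<lhd> b)" for a b c
    using cocycle_pure[of 3 a b c] assms[of 4] by simp
  \<comment> \<open>At \<open>\<lambda>\<^sup>3\<mu>\<close>, after removing the summand of \<open>b \<star> c\<close> that \<open>pure\<close> identifies.\<close>
  have r: "A 3 (a \<^bold>* b) c = A 3 a (b \<rhd> c)" for a b c
  proof -
    have "3 * A 3 (a \<^bold>* b) c - A 3 (b \<^bold>* a) c = A 3 a (b \<rhd> c) + A 3 a (c \<lhd> b)"
      using cocycle_linear[of 2 a b c] assms[of 4]
      by (simp add: form_coeff_add(1))
    then have "3 * A 3 (a \<^bold>* b) c - A 3 (a \<^bold>* b) c = A 3 a (b \<rhd> c) + A 3 (a \<^bold>* b) c"
      unfolding sym[of b a c] pure[of a b c] .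
    then show ?thesis
      by (simp add: algebra_simps)
  qed
  show "A 3 (a \<^bold>* b) c = A 3 (b \<^bold>* a) c"
    by (rule sym)
  show "A 3 (b \<^bold>* a) c = A 3 a (c \<lhd> b)"
    using sym pure by simp
  show "A 3 a (c \<lhd> b) = A 3 b (a \<rhd> c)"
    using sym pure r by simp
  show "A 2 (a \<^bold>* b) c - A 2 a (c \<lhd> b) - \<beta> * A 3 a (c \<lhd> b) - A 3 a (b \<odot> c)
          = A 3 (b \<odot> a) c - A 3 (a \<odot> b) c"
    using cocycle_pure[of 2 a b c] by (simp add: algebra_simps)
  show "2 * A 2 (a \<^bold>* b) c - A 2 (b \<^bold>* a) c - A 2 a (b \<star> c)
          = 3 * A 3 (b \<odot> a) c - 3 * A 3 (a \<odot> b) c"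
    using cocycle_linear[of 1 a b c] by (simp add: numeral_eq_Suc algebra_simps)
  show "A 1 (a \<^bold>* b) c - A 1 a (c \<lhd> b) - \<beta> * A 2 a (c \<lhd> b) - A 2 a (b \<odot> c)
          = A 2 (b \<odot> a) c - A 2 (a \<odot> b) c"
    using cocycle_pure[of 1 a b c] by (simp add: numeral_eq_Suc algebra_simps)
  show "A 1 (a \<^bold>* b) c - A 1 (b \<^bold>* a) c - A 1 a (b \<star> c) + A 1 b (a \<star> c)
          = 2 * A 2 (b \<odot> a) c - 2 * A 2 (a \<odot> b) c"
    using cocycle_linear[of 0 a b c] by (simp add: numeral_eq_Suc algebra_simps)
  show "A 0 (a \<^bold>* b) c - A 0 a (c \<lhd> b) + A 0 b (a \<star> c) - \<beta> * A 1 a (c \<lhd> b) - A 1 a (b \<odot> c)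
          = A 1 (b \<odot> a) c - A 1 (a \<odot> b) c"
    using cocycle_pure[of 0 a b c] by (simp add: algebra_simps)
  show "A 0 (a \<odot> b) c - \<beta> * A 0 a (c \<lhd> b) - A 0 a (b \<odot> c)
          = A 0 (b \<odot> a) c - \<beta> * A 0 b (c \<lhd> a) - A 0 b (a \<odot> c)"
    using cocycle_coeff[where i = 0 and j = 0 and a = a and b = b and c = c] by (simp add: algebra_simps)
qed

end

section \<open>Equivalence of extensions\<close>

text \<open>
  A linear map that fixes the central element and induces the identity on R has the form
  \<open>(x, z) \<mapsto> (x, f x + z)\<close> with \<open>f\<close> linear. It commutes with \<open>\<partial>\<close> exactly when
  \<open>f (\<partial>x) = \<beta> f x\<close>, and comparing central components, it respects the products exactly when the
  two forms differ by \<open>f\<close> applied to the \<open>\<lambda>\<close>-product of R.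
\<close>

lemma equivalent_extensions_iff_coboundary:
  assumes ext: "central_extension scale D lprod \<beta> \<alpha>" and ext': "central_extension scale D lprod \<beta> \<alpha>'"
  shows "equivalent_extensions scale D lprod \<beta> \<alpha> \<alpha>' \<longleftrightarrow>
    (\<exists>f. Vector_Spaces.linear scale (*) f \<and> (\<forall>x. f (D x) = \<beta> * f x) \<and>
         (\<forall>x y. \<alpha>' x y = \<alpha> x y + map_poly f (lprod x y)))" (is "_ \<longleftrightarrow> ?cob")
proof -
  let ?s = "ext_scale scale"
  let ?P = "ext_lprod lprod \<alpha>" and ?P' = "ext_lprod lprod \<alpha>'"
  have bil: "bilinear_map scale scale smult \<alpha>"
    using ext by (simp add: central_extension_def)
  have vs: "vector_space scale"
    using bil by (simp add: bilinear_map_def Vector_Spaces.linear_iff)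
  have vs': "vector_space ?s"
    using ext by (simp add: central_extension_def left_symmetric_conformal_algebra_def)
  have image: "map_poly (\<lambda>u. (fst u, f (fst u) + snd u)) (?P u v) = ?P' (fst u, z) (fst v, w) \<longleftrightarrow>
      \<alpha>' (fst u) (fst v) = \<alpha> (fst u) (fst v) + map_poly f (lprod (fst u) (fst v))"
    if "f 0 = 0" for f u v z w
    by (auto simp: poly_eq_iff ext_lprod_def coeff_map_poly that add.commute zero_prod_def)
  show ?thesis
  proof
    assume "equivalent_extensions scale D lprod \<beta> \<alpha> \<alpha>'"
    then obtain \<phi> where \<phi>: "Vector_Spaces.linear ?s ?s \<phi>"
      and D: "\<And>u. \<phi> (ext_D D \<beta> u) = ext_D D \<beta> (\<phi> u)"
      and mult: "\<And>u v. map_poly \<phi> (?P u v) = ?P' (\<phi> u) (\<phi> v)"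
      and c: "\<And>z. \<phi> (0, z) = (0, z)" and R: "\<And>x z. fst (\<phi> (x, z)) = x"
      by (auto simp: equivalent_extensions_def lsca_hom_def)
    interpret \<phi>: additive \<phi> using \<phi> by (rule linear_additive)
    define f where "f = (\<lambda>x. snd (\<phi> (x, 0)))"
    have \<phi>_eq: "\<phi> u = (fst u, f (fst u) + snd u)" for u
    proof -
      have "\<phi> u = \<phi> (fst u, 0) + \<phi> (0, snd u)"
        by (simp flip: \<phi>.add)
      also have "\<phi> (fst u, 0) = (fst u, f (fst u))"
        by (simp add: f_def R prod_eq_iff)
      finally show ?thesis
        by (simp add: c)
    qed
    have add: "f (x + y) = f x + f y" for x y
      using \<phi>.add[of "(x, 0)" "(y, 0)"] by (simp add: \<phi>_eq)
    have "f (scale k x) = k * f x" for k x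
    proof -
      have "\<phi> (?s k (x, 0)) = ?s k (\<phi> (x, 0))"
        using \<phi> by (simp add: Vector_Spaces.linear_iff)
      then show ?thesis
        by (simp add: \<phi>_eq ext_scale_def)
    qed
    with add have "Vector_Spaces.linear scale (*) f"
      by (simp add: Vector_Spaces.linear_iff vs vector_space_complex)
    moreover have "f (D x) = \<beta> * f x" for x
      using D[of "(x, 0)"] by (simp add: \<phi>_eq ext_D_def)
    moreover have "\<alpha>' x y = \<alpha> x y + map_poly f (lprod x y)" for x y
    proof -
      have "f 0 = 0"
        using add[of 0 0] by simp
      then show ?thesis
        using mult[of "(x, 0)" "(y, 0)"] image[of f "(x, 0)" "(y, 0)" "f x" "f y"] unfolding \<phi>_eq by simp
    qed
    ultimately show ?cob by blast
  next
    assume ?cob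
    then obtain f where f: "Vector_Spaces.linear scale (*) f" and D: "\<And>x. f (D x) = \<beta> * f x"
      and \<alpha>': "\<And>x y. \<alpha>' x y = \<alpha> x y + map_poly f (lprod x y)"
      by blast
    interpret f: additive f using f by (rule linear_additive)
    have scale: "f (scale k x) = k * f x" for k x
      using f by (simp add: Vector_Spaces.linear_iff)
    let ?\<phi> = "\<lambda>u. (fst u, f (fst u) + snd u)"
    have "Vector_Spaces.linear ?s ?s ?\<phi>"
      by (simp add: Vector_Spaces.linear_iff vs' f.add scale ext_scale_def algebra_simps)
    moreover have "?\<phi> (ext_D D \<beta> u) = ext_D D \<beta> (?\<phi> u)" for u
      by (simp add: ext_D_def D algebra_simps)
    moreover have "map_poly ?\<phi> (?P u v) = ?P' (?\<phi> u) (?\<phi> v)" for u v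
      unfolding image[where f = f, OF f.zero] by (rule \<alpha>')
    ultimately show "equivalent_extensions scale D lprod \<beta> \<alpha> \<alpha>'"
      unfolding equivalent_extensions_def lsca_hom_def
      by (intro exI[of _ ?\<phi>]) (simp add: f.zero)
  qed
qed

text \<open>
  Uniqueness of the sesquilinear extension: the elements of V generate \<open>\<complex>[\<partial>]V\<close> over \<open>\<complex>[\<partial>]\<close>.
\<close>

lemma sesquilinear_zero:
  fixes g :: "'v::ab_group_add poly \<Rightarrow> 'v poly \<Rightarrow> complex poly"
  assumes "\<And>x. additive (g x)" and "\<And>y. additive (\<lambda>x. g x y)"
    and left: "\<And>x y. g (free_D x) y = - pCons 0 (g x y)"
    and right: "\<And>x y. g x (free_D y) = smult \<beta> (g x y) + pCons 0 (g x y)"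
    and const: "\<And>a b. g [:a:] [:b:] = 0"
  shows "g x y = 0"
proof -
  note add = additive.add[OF assms(1)] additive.add[OF assms(2)]
  note zero = additive.zero[OF assms(1)] additive.zero[OF assms(2)]
  have split: "pCons a p = [:a:] + free_D p" for a :: 'v and p
    by (simp add: free_D_def)
  have const_left: "g [:a:] y = 0" for a y
  proof (induction y)
    case (pCons b y)
    have "g [:a:] ([:b:] + free_D y) = 0"
      by (simp only: add right const pCons.IH) simp
    then show ?case
      by (simp only: split[symmetric])
  qed (simp add: zero)
  show ?thesis
  proof (induction x)
    case (pCons a x)
    have "g ([:a:] + free_D x) y = 0"
      by (simp only: add left const_left pCons.IH) simp
    then show ?case
      by (simp only: split[symmetric])
  qed (simp add: zero)
qed

text \<open>
  The only additive map \<open>f\<close> on \<open>\<complex>[\<partial>]V\<close> with \<open>f (\<partial>x) = \<beta> f x\<close> that restricts to an additive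
  \<open>\<phi>\<close> on V: it sends \<open>\<Sum>i. \<partial>\<^sup>i v\<^sub>i\<close> to \<open>\<Sum>i. \<beta>\<^sup>i \<phi> v\<^sub>i\<close>.
\<close>

definition extend_form :: "complex \<Rightarrow> ('v::zero \<Rightarrow> complex) \<Rightarrow> 'v poly \<Rightarrow> complex" where
  "extend_form \<beta> \<phi> x = poly (map_poly \<phi> x) \<beta>"

context quadratic_central_extension begin

lemma linear_extend_form:
  assumes \<phi>: "Vector_Spaces.linear scale (*) \<phi>"
  shows "Vector_Spaces.linear (free_scale scale) (*) (extend_form \<beta> \<phi>)"
    and "extend_form \<beta> \<phi> (free_D x) = \<beta> * extend_form \<beta> \<phi> x"
    and "extend_form \<beta> \<phi> [:a:] = \<phi> a"
proof -
  have "bilinear_map (free_scale scale) (free_scale scale) smult \<alpha>"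
    using extension by (simp add: central_extension_def)
  then have "vector_space (free_scale scale)"
    by (simp add: bilinear_map_def Vector_Spaces.linear_iff)
  moreover have "map_poly \<phi> (free_scale scale k x) = smult k (map_poly \<phi> x)" for k x
    using \<phi> by (intro poly_eqI)
       (simp add: free_scale_def coeff_map_poly additive.zero[OF linear_additive[OF \<phi>]] Vector_Spaces.linear_iff)
  ultimately show "Vector_Spaces.linear (free_scale scale) (*) (extend_form \<beta> \<phi>)"
    by (simp add: Vector_Spaces.linear_iff vector_space_complex extend_form_def
        additive.add[OF additive_map_poly[OF linear_additive[OF \<phi>]]])
  show "extend_form \<beta> \<phi> (free_D x) = \<beta> * extend_form \<beta> \<phi> x" "extend_form \<beta> \<phi> [:a:] = \<phi> a"
    using additive.zero[OF linear_additive[OF \<phi>]]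
    by (simp_all add: extend_form_def free_D_def map_poly_pCons)
qed

lemma map_poly_quad_base:
  assumes "additive f" and "\<And>x. f (free_D x) = \<beta> * f x"
  shows "map_poly f (quad_lprod (\<lhd>) (\<rhd>) (\<odot>) [:a:] [:b:])
    = [:f [:a \<odot> b:] + \<beta> * f [:b \<lhd> a:], f [:a \<star> b:]:]"
proof -
  interpret additive f by fact
  have "[:a \<odot> b, b \<lhd> a:] = [:a \<odot> b:] + free_D [:b \<lhd> a:]"
    by (simp add: free_D_def)
  then show ?thesis
    by (simp add: quad_lprod_const quad_base_def map_poly_pCons zero add assms(2) del: add_pCons)
qed

text \<open>
  Both forms and the coboundary are sesquilinear, so it suffices to compare them on generators.
\<close>

lemma coboundary_iff_const:
  assumes ext': "central_extension (free_scale scale) free_D (quad_lprod (\<lhd>) (\<rhd>) (\<odot>)) \<beta> \<alpha>'"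
    and "additive f" and D: "\<And>x. f (free_D x) = \<beta> * f x"
  shows "(\<forall>x y. \<alpha>' x y = \<alpha> x y + map_poly f (quad_lprod (\<lhd>) (\<rhd>) (\<odot>) x y)) \<longleftrightarrow>
    (\<forall>a b. \<alpha>' [:a:] [:b:] = \<alpha> [:a:] [:b:]
      + [:f [:a \<odot> b:] + \<beta> * f [:b \<lhd> a:], f [:a \<star> b:]:])" (is "?all \<longleftrightarrow> ?const")
proof
  assume ?all
  then show ?const
    by (simp add: map_poly_quad_base[OF assms(2,3)])
next
  assume const: ?const
  interpret f: additive f by fact
  interpret F: additive "map_poly f" by (rule additive_map_poly) fact
  let ?g = "\<lambda>x y. \<alpha>' x y - \<alpha> x y - map_poly f (quad_lprod (\<lhd>) (\<rhd>) (\<odot>) x y)"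
  note S = central_extension_sesquilinear[OF ext'] sesquilinear
  have fD: "map_poly f (map_poly free_D q) = smult \<beta> (map_poly f q)" for q
    by (rule poly_eqI) (simp add: coeff_map_poly f.zero free_D_def D[unfolded free_D_def])
  have fp: "map_poly f (pCons 0 q) = pCons 0 (map_poly f q)" for q
    by (simp add: map_poly_pCons f.zero)
  have "?g x y = 0" for x y
  proof (rule sesquilinear_zero[where g = ?g and \<beta> = \<beta>])
    show "additive (?g x)" "additive (\<lambda>x. ?g x y)" for x y
      using central_extension_biadditive[OF ext'] central_extension_biadditive[OF extension]
      by (simp_all add: additive_def F.add)
    show "?g (free_D x) y = - pCons 0 (?g x y)" for x y
      by (simp add: S(1,3,5,7) F.minus fp)
    show "?g x (free_D y) = smult \<beta> (?g x y) + pCons 0 (?g x y)" for x y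
      by (simp add: S(2,4,6,8) F.add fD fp smult_diff_right)
    show "?g [:a:] [:b:] = 0" for a b
      using const by (simp add: map_poly_quad_base[OF assms(2,3)])
  qed
  then show ?all
    by (simp add: diff_diff_eq)
qed

text \<open>
  The map \<open>\<phi>\<close> is minus the restriction of the coboundary map to V: the sign enters because
  \<open>\<alpha>\<close> is expressed through \<open>\<alpha>'\<close>.
\<close>

lemma equivalent_iff:
  assumes ext': "central_extension (free_scale scale) free_D (quad_lprod (\<lhd>) (\<rhd>) (\<odot>)) \<beta> \<alpha>'"
  shows "equivalent_extensions (free_scale scale) free_D (quad_lprod (\<lhd>) (\<rhd>) (\<odot>)) \<beta> \<alpha> \<alpha>' \<longleftrightarrow>
    (\<exists>\<phi>. Vector_Spaces.linear scale (*) \<phi> \<and>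
      (\<forall>a b. \<alpha> [:a:] [:b:] = \<alpha>' [:a:] [:b:] + [:\<beta> * \<phi> (b \<lhd> a) + \<phi> (a \<odot> b), \<phi> (a \<star> b):]))"
    (is "?eq \<longleftrightarrow> (\<exists>\<phi>. ?lin \<phi> \<and> ?rel \<phi>)")
proof
  assume ?eq
  then obtain f where f: "Vector_Spaces.linear (free_scale scale) (*) f"
    and D: "\<And>x. f (free_D x) = \<beta> * f x"
    and cob: "\<forall>x y. \<alpha>' x y = \<alpha> x y + map_poly f (quad_lprod (\<lhd>) (\<rhd>) (\<odot>) x y)"
    using equivalent_extensions_iff_coboundary[OF extension ext'] by blast
  let ?\<phi> = "\<lambda>a. - f [:a:]"
  interpret f: additive f using f by (rule linear_additive)
  have "f [:scale k a:] = k * f [:a:]" for k a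
  proof -
    have "f (free_scale scale k [:a:]) = k * f [:a:]"
      using f by (simp add: Vector_Spaces.linear_iff)
    then show ?thesis
      by (simp add: free_scale_def map_poly_pCons)
  qed
  moreover have "f [:a + b:] = f [:a:] + f [:b:]" for a b
    using f.add[of "[:a:]" "[:b:]"] by simp
  ultimately have "?lin ?\<phi>"
    by (simp add: Vector_Spaces.linear_iff vector_space_axioms vector_space_complex)
  moreover have "?rel ?\<phi>"
    using cob coboundary_iff_const[OF ext' f.additive_axioms D] by simp
  ultimately show "\<exists>\<phi>. ?lin \<phi> \<and> ?rel \<phi>" by blast
next
  assume "\<exists>\<phi>. ?lin \<phi> \<and> ?rel \<phi>"
  then obtain \<phi> where \<phi>: "?lin \<phi>" and rel: "?rel \<phi>" by blast
  have \<psi>: "?lin (\<lambda>a. - \<phi> a)"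
    using \<phi> by (simp add: Vector_Spaces.linear_iff)
  let ?f = "extend_form \<beta> (\<lambda>a. - \<phi> a)"
  note ext_form = linear_extend_form[OF \<psi>]
  have "\<alpha>' [:a:] [:b:] = \<alpha> [:a:] [:b:]
      + [:?f [:a \<odot> b:] + \<beta> * ?f [:b \<lhd> a:], ?f [:a \<star> b:]:]" for a b
    using rel by (simp add: ext_form(3))
  then show ?eq
    unfolding equivalent_extensions_iff_coboundary[OF extension ext']
    using ext_form(1,2) coboundary_iff_const[OF ext' linear_additive[OF ext_form(1)] ext_form(2)]
    by blast
qed

end

section \<open>The classification\<close>

theorem corollary3p4:
  fixes scale :: "complex \<Rightarrow> 'v::ab_group_add \<Rightarrow> 'v"
    and l :: "'v \<Rightarrow> 'v \<Rightarrow> 'v" (infixl "\<lhd>" 70)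
    and r :: "'v \<Rightarrow> 'v \<Rightarrow> 'v" (infixl "\<rhd>" 70)
    and m :: "'v \<Rightarrow> 'v \<Rightarrow> 'v" (infixl "\<odot>" 70)
    and ast :: "'v \<Rightarrow> 'v \<Rightarrow> 'v" (infixl "\<^bold>*" 70)
    and star :: "'v \<Rightarrow> 'v \<Rightarrow> 'v" (infixl "\<star>" 70)
    and \<beta> :: complex
    and \<alpha> \<alpha>' :: "'v poly \<Rightarrow> 'v poly \<Rightarrow> complex poly"
    and A A' :: "nat \<Rightarrow> 'v \<Rightarrow> 'v \<Rightarrow> complex"
  assumes "\<exists>B. finite_dimensional_vector_space scale B"
    and "pre_Gelfand_Dorfman_algebra scale (\<lhd>) (\<rhd>) (\<odot>)"
    and ast: "(\<^bold>*) = (\<lambda>a b. a \<rhd> b + a \<lhd> b)"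
    and star: "(\<star>) = (\<lambda>a b. a \<rhd> b + b \<lhd> a)"
    and "products_span scale (\<^bold>*) \<or> products_span scale (\<star>) \<or>
         products_span scale (\<lhd>) \<or> products_span scale (\<rhd>)"
    and "central_extension (free_scale scale) free_D (quad_lprod (\<lhd>) (\<rhd>) (\<odot>)) \<beta> \<alpha>"
    and "central_extension (free_scale scale) free_D (quad_lprod (\<lhd>) (\<rhd>) (\<odot>)) \<beta> \<alpha>'"
    and A: "A = form_coeff \<alpha>"
    and A': "A' = form_coeff \<alpha>'"
  shows
    "(\<forall>a b. \<alpha> [:a:] [:b:] = (\<Sum>i\<le>3. monom (A i a b) i)) \<and>
     (\<forall>i\<le>3. bilinear_map scale scale (*) (A i)) \<and>
     (\<forall>a b c.
        A 3 (a \<^bold>* b) c = A 3 (b \<^bold>* a) c \<and>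
        A 3 (b \<^bold>* a) c = A 3 a (c \<lhd> b) \<and>
        A 3 a (c \<lhd> b) = A 3 b (a \<rhd> c) \<and>
        A 2 (a \<^bold>* b) c - A 2 a (c \<lhd> b) - \<beta> * A 3 a (c \<lhd> b) - A 3 a (b \<odot> c)
          = A 3 (b \<odot> a) c - A 3 (a \<odot> b) c \<and>
        2 * A 2 (a \<^bold>* b) c - A 2 (b \<^bold>* a) c - A 2 a (b \<star> c)
          = 3 * A 3 (b \<odot> a) c - 3 * A 3 (a \<odot> b) c \<and>
        A 1 (a \<^bold>* b) c - A 1 a (c \<lhd> b) - \<beta> * A 2 a (c \<lhd> b) - A 2 a (b \<odot> c)
          = A 2 (b \<odot> a) c - A 2 (a \<odot> b) c \<and>
        A 1 (a \<^bold>* b) c - A 1 (b \<^bold>* a) c - A 1 a (b \<star> c) + A 1 b (a \<star> c)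
          = 2 * A 2 (b \<odot> a) c - 2 * A 2 (a \<odot> b) c \<and>
        A 0 (a \<^bold>* b) c - A 0 a (c \<lhd> b) + A 0 b (a \<star> c) - \<beta> * A 1 a (c \<lhd> b) - A 1 a (b \<odot> c)
          = A 1 (b \<odot> a) c - A 1 (a \<odot> b) c \<and>
        A 0 (a \<odot> b) c - \<beta> * A 0 a (c \<lhd> b) - A 0 a (b \<odot> c)
          = A 0 (b \<odot> a) c - \<beta> * A 0 b (c \<lhd> a) - A 0 b (a \<odot> c)) \<and>
     (equivalent_extensions (free_scale scale) free_D (quad_lprod (\<lhd>) (\<rhd>) (\<odot>)) \<beta> \<alpha> \<alpha>' \<longleftrightarrow>
        A 2 = A' 2 \<and> A 3 = A' 3 \<and>
        (\<exists>\<phi>. Vector_Spaces.linear scale (*) \<phi> \<and>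
             (\<forall>a b. A 1 a b = A' 1 a b + \<phi> (a \<rhd> b + b \<lhd> a) \<and>
                    A 0 a b = A' 0 a b + \<beta> * \<phi> (b \<lhd> a) + \<phi> (a \<odot> b))))"
proof -
  interpret pre_Gelfand_Dorfman_algebra scale "(\<lhd>)" "(\<rhd>)" "(\<odot>)" by fact
  interpret E: quadratic_central_extension scale "(\<lhd>)" "(\<rhd>)" "(\<odot>)" \<beta> \<alpha>
    by standard fact
  interpret E': quadratic_central_extension scale "(\<lhd>)" "(\<rhd>)" "(\<odot>)" \<beta> \<alpha>'
    by standard fact
  obtain B where B: "finite_dimensional_vector_space scale B"
    using assms(1) by blast
  note span = assms(5)[unfolded ast star]
  note zero = E.form_coeff_eq_0[OF B span] and zero' = E'.form_coeff_eq_0[OF B span]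
  \<comment> \<open>The coboundary has degree at most 1, so it leaves the components 2 and 3 unchanged, and the
    components from 4 on vanish on both sides.\<close>
  have rel: "(\<forall>a b. \<alpha> [:a:] [:b:] = \<alpha>' [:a:] [:b:] + [:\<beta> * \<phi> (b \<lhd> a) + \<phi> (a \<odot> b), \<phi> (a \<rhd> b + b \<lhd> a):])
    \<longleftrightarrow> A 2 = A' 2 \<and> A 3 = A' 3 \<and>
      (\<forall>a b. A 1 a b = A' 1 a b + \<phi> (a \<rhd> b + b \<lhd> a) \<and>
             A 0 a b = A' 0 a b + \<beta> * \<phi> (b \<lhd> a) + \<phi> (a \<odot> b))" (is "?L \<longleftrightarrow> ?R") for \<phi>
  proof
    assume L: ?L
    have "A i a b = A' i a b + coeff [:\<beta> * \<phi> (b \<lhd> a) + \<phi> (a \<odot> b), \<phi> (a \<rhd> b + b \<lhd> a):] i" for i a b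
      using L by (simp add: A A' form_coeff_def)
    then show ?R
      by (simp add: fun_eq_iff numeral_eq_Suc)
  next
    assume R: ?R
    have "coeff (\<alpha> [:a:] [:b:]) i = coeff (\<alpha>' [:a:] [:b:] +
      [:\<beta> * \<phi> (b \<lhd> a) + \<phi> (a \<odot> b), \<phi> (a \<rhd> b + b \<lhd> a):]) i" for i a b
    proof -
      consider "i = 0" | "i = 1" | "i = 2" | "i = 3" | "4 \<le> i" by linarith
      then show ?thesis
      proof cases
        case 5
        then show ?thesis
          using zero[OF 5, of a b] zero'[OF 5, of a b]
          by (simp add: form_coeff_def coeff_pCons split: nat.split)
      qed (use R in \<open>auto simp: A A' form_coeff_def fun_eq_iff numeral_eq_Suc\<close>)
    qed
    then show ?L
      by (simp add: poly_eq_iff)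
  qed
  show ?thesis
    unfolding E.equivalent_iff[OF E'.extension] rel
    unfolding A ast star
    using E.form_eq_sum_monom[OF zero, simplified]
    by (intro conjI allI impI E.bilinear_form_coeff E.cocycle_relations zero) blast+
qed

end
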